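(* Let $W\ge1$ be an integer and let $\epsilon>0$ be such that $k=\frac{1}{2\epsilon}$ and $\frac{W}{k}$ are integers. Then Algorithm 1 (described in the context, run with these parameters) provides a $W\epsilon$-additive approximation of Basic-Counting; that is, for every input bit stream and at every time, the value $\widehat{C^W}$ returned by Query satisfies $|\widehat{C^W}-C^W|\le W\epsilon$.
   Context: Basic-Counting: given a stream of bits arriving one at a time and a window size $W$, maintain $C^W$, the number of 1's among the last $W$ bits of the stream (bits before the beginning of the stream are regarded as 0). Algorithm 1. Variables: integers $y,m,i,B$ and a bit array $b=(b_0,\dots,b_{k-1})$, all initialized to $0$. Add(bit $x$): If $m=\frac Wk-1$, then do in order: (1) $B\leftarrow B-b_i$; (2) if $y+x\ge\frac Wk$, set $b_i\leftarrow1$ and $y\leftarrow y-\frac Wk+x$; otherwise set $b_i\leftarrow0$ and $y\leftarrow y+x$; (3) $B\leftarrow B+b_i$; (4) $m\leftarrow0$; (5) $i\leftarrow i+1 \bmod k$. Otherwise (if $m\neq\frac Wk-1$): $y\leftarrow y+x$ and $m\leftarrow m+1$. Query: return $\frac Wk\cdot B+y-\frac{W}{2k}-m\cdot b_i$. Each arriving stream bit is processed by one call of Add. *)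

theory Defs
  imports Complex_Main
begin

text \<open>
  A stream is a function \<open>s :: nat \<Rightarrow> bool\<close>, where \<open>s j\<close> is the bit arriving as number \<open>j + 1\<close>
  and \<open>True\<close> is the bit 1; time \<open>t\<close> is the moment after exactly \<open>t\<close> arrivals.
\<close>

text \<open>The lower end \<open>t - W\<close> is written additively, so that for \<open>t < W\<close> the positions before the
  beginning of the stream contribute nothing.\<close>

definition window_count :: "nat \<Rightarrow> (nat \<Rightarrow> bool) \<Rightarrow> nat \<Rightarrow> nat" where
  "window_count W s t = card {j. j < t \<and> t \<le> j + W \<and> s j}"

record counter =
  cnt_y :: int
  cnt_m :: int
  cnt_i :: nat
  cnt_B :: int
  cnt_b :: "bool list"

definition counter_init :: "nat \<Rightarrow> counter" where
  "counter_init k =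
     \<lparr>cnt_y = 0, cnt_m = 0, cnt_i = 0, cnt_B = 0, cnt_b = replicate k False\<rparr>"

text \<open>The block size \<open>W / k\<close> is rendered as an integer quotient; it is the exact quotient whenever
  \<open>k\<close> divides \<open>W\<close>, which is the only case in which the algorithm is meant to be run.\<close>

definition counter_add :: "nat \<Rightarrow> nat \<Rightarrow> bool \<Rightarrow> counter \<Rightarrow> counter" where
  "counter_add W k x c =
     (let n = int (W div k); y = cnt_y c; m = cnt_m c; i = cnt_i c; B = cnt_B c; b = cnt_b c in
      if m = n - 1 then
        (let B = B - of_bool (b ! i);
             (b, y) = (if y + of_bool x \<ge> n then (b[i := True], y - n + of_bool x)
                       else (b[i := False], y + of_bool x));
             B = B + of_bool (b ! i)
         in \<lparr>cnt_y = y, cnt_m = 0, cnt_i = (i + 1) mod k, cnt_B = B, cnt_b = b\<rparr>)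
      else c\<lparr>cnt_y := y + of_bool x, cnt_m := m + 1\<rparr>)"

definition counter_query :: "nat \<Rightarrow> nat \<Rightarrow> counter \<Rightarrow> real" where
  "counter_query W k c =
     real W / real k * of_int (cnt_B c) + of_int (cnt_y c) - real W / (2 * real k)
       - of_int (cnt_m c) * of_bool (cnt_b c ! cnt_i c)"

primrec counter_run :: "nat \<Rightarrow> nat \<Rightarrow> (nat \<Rightarrow> bool) \<Rightarrow> nat \<Rightarrow> counter" where
  "counter_run W k s 0 = counter_init k"
| "counter_run W k s (Suc t) = counter_add W k (s t) (counter_run W k s t)"

end

theory Submission imports Defs
begin

text \<open>
  Write \<open>n = W / k\<close>, let \<open>P t\<close> be the number of ones among the first \<open>t\<close> bits and
  \<open>S q = \<lfloor>P (q n) / n\<rfloor>\<close>. The bit recorded for block \<open>q\<close> is \<open>S (q + 1) - S q\<close>, so after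
  \<open>t = q n + m\<close> arrivals the remainder is \<open>y = P t - n S q\<close> and \<open>B = S q - S (q - k)\<close>. Hence
  \<open>n B + y - C\<^sup>W = P (t - W) - n S (q - k)\<close>, which is the value of the remainder at time \<open>t - W\<close>.
  The bit \<open>b\<^sub>i\<close> is the one recorded for block \<open>q - k\<close>, i.e. it tells whether the remainder reaches
  \<open>n\<close> at the end of that block, and this keeps the old remainder minus \<open>m b\<^sub>i\<close> in \<open>[0, n]\<close>;
  subtracting \<open>n / 2\<close> centres the error.
\<close>

definition ones :: "(nat \<Rightarrow> bool) \<Rightarrow> nat \<Rightarrow> nat" where
  "ones s t = (\<Sum>j<t. of_bool (s j))"

text \<open>Counts the groups of \<open>n\<close> ones completed within the first \<open>q\<close>
  blocks, not the blocks that consist of ones only.\<close>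

definition full_blocks :: "nat \<Rightarrow> (nat \<Rightarrow> bool) \<Rightarrow> nat \<Rightarrow> nat" where
  "full_blocks n s q = ones s (q * n) div n"

lemma ones_0 [simp]: "ones s 0 = 0"
  and ones_Suc [simp]: "ones s (Suc t) = ones s t + of_bool (s t)"
  by (simp_all add: ones_def)

lemma full_blocks_0 [simp]: "full_blocks n s 0 = 0"
  by (simp add: full_blocks_def)

lemma ones_eq_card: "ones s t = card {j. j < t \<and> s j}"
  by (simp add: ones_def sum.If_cases of_bool_def Int_def)

lemma ones_le_add: "ones s t \<le> ones s (t + d)"
  by (induction d) auto

lemma ones_add_le: "ones s (t + d) \<le> ones s t + d"
  by (induction d) auto

text \<open>The window is one prefix of the stream minus a shorter one; for \<open>t < W\<close>
  truncation makes the shorter prefix empty.\<close>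

lemma window_count_eq: "window_count W s t = ones s t - ones s (t - W)"
proof -
  have "{j. j < t \<and> t \<le> j + W \<and> s j} = {j. j < t \<and> s j} - {j. j < t - W \<and> s j}"
    by auto
  moreover have "card ({j. j < t \<and> s j} - {j. j < t - W \<and> s j})
      = card {j. j < t \<and> s j} - card {j. j < t - W \<and> s j}"
    by (rule card_Diff_subset) auto
  ultimately show ?thesis
    by (simp add: window_count_def ones_eq_card)
qed

text \<open>A block brings at most \<open>n\<close> new ones, so the quotient grows by at most one
  and a single bit per block records it.\<close>

lemma full_blocks_Suc:
  assumes "n > 0"
  shows "full_blocks n s (Suc q)
    = full_blocks n s q + of_bool (full_blocks n s q < full_blocks n s (Suc q))"
proof -
  have "ones s (q * n) \<le> ones s (Suc q * n)" "ones s (Suc q * n) \<le> ones s (q * n) + n"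
    using ones_le_add[of s "q * n" n] ones_add_le[of s "q * n" n] by (simp_all add: add.commute)
  then have "full_blocks n s q \<le> full_blocks n s (Suc q)"
    "full_blocks n s (Suc q) \<le> (ones s (q * n) + n) div n"
    unfolding full_blocks_def by (auto intro: div_le_mono)
  with assms show ?thesis
    by (auto simp: full_blocks_def)
qed

text \<open>A slot of the bit array is read \<open>k\<close> blocks after it was written, so slot \<open>j mod k\<close> is described
  at the block \<open>j\<close> where it is next read. Truncated subtraction makes this the initial bit \<open>0\<close> when
  \<open>j < k\<close>.\<close>

lemma counter_run_invariant:
  fixes n k :: nat and s :: "nat \<Rightarrow> bool"
  assumes n: "n > 0" and k: "k > 0"
  defines "S \<equiv> full_blocks n s"
  shows "cnt_y (counter_run (n * k) k s t) = int (ones s t) - int n * int (S (t div n))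
    \<and> cnt_m (counter_run (n * k) k s t) = int (t mod n)
    \<and> cnt_i (counter_run (n * k) k s t) = t div n mod k
    \<and> cnt_B (counter_run (n * k) k s t) = int (S (t div n)) - int (S (t div n - k))
    \<and> length (cnt_b (counter_run (n * k) k s t)) = k
    \<and> (\<forall>j. t div n \<le> j \<and> j < t div n + k \<longrightarrow>
          cnt_b (counter_run (n * k) k s t) ! (j mod k) = (S (j - k) < S (Suc j - k)))"
proof (induction t)
  case 0
  then show ?case
    using k by (auto simp: counter_init_def S_def)
next
  case (Suc t)
  define c where "c = counter_run (n * k) k s t"
  define q where "q = t div n"
  define x where "x = s t"
  have step: "counter_run (n * k) k s (Suc t) = counter_add (n * k) k x c"
    by (simp add: c_def x_def)
  have wk: "n * k div k = n" using k by simp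
  have y: "cnt_y c = int (ones s t) - int n * int (S q)"
    and m: "cnt_m c = int (t mod n)"
    and i: "cnt_i c = q mod k"
    and B: "cnt_B c = int (S q) - int (S (q - k))"
    and len: "length (cnt_b c) = k"
    and b: "\<And>j. q \<le> j \<Longrightarrow> j < q + k \<Longrightarrow> cnt_b c ! (j mod k) = (S (j - k) < S (Suc j - k))"
    using Suc.IH by (auto simp: c_def q_def)
  show ?case
  proof (cases "Suc (t mod n) = n")
    case True
    then have dm: "Suc t div n = Suc q" "Suc t mod n = 0"
      by (auto simp: div_Suc mod_Suc q_def)
    have Suct: "Suc t = Suc q * n"
      using div_mult_mod_eq[of "Suc t" n] unfolding dm by simp
    \<comment> \<open>The threshold test: \<open>cnt_y c + of_bool x\<close> equals
      \<open>ones s (Suc t) - n * S q\<close>, which reaches \<open>n\<close> exactly when the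
      quotient at the block's end exceeds \<open>S q\<close>.\<close>
    have full: "int n \<le> cnt_y c + of_bool x \<longleftrightarrow> S q < S (Suc q)"
    proof -
      have "S q < S (Suc q) \<longleftrightarrow> Suc (S q) \<le> ones s (Suc t) div n"
        by (simp add: S_def full_blocks_def Suct del: ones_Suc mult_Suc) linarith
      also have "\<dots> \<longleftrightarrow> n * Suc (S q) \<le> ones s (Suc t)"
        using n by (simp add: less_eq_div_iff_mult_less_eq mult.commute del: ones_Suc)
      also have "\<dots> \<longleftrightarrow> int (n * Suc (S q)) \<le> int (ones s (Suc t))"
        by (rule of_nat_le_iff[symmetric])
      finally show ?thesis
        unfolding y by (auto simp: x_def algebra_simps)
    qed
    have inc: "int (S (Suc q)) = int (S q) + of_bool (S q < S (Suc q))"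
      using arg_cong[OF full_blocks_Suc[OF n, of s q], of int] unfolding S_def by simp
    \<comment> \<open>The bit leaving \<open>B\<close> is the increment at block
      \<open>q - k\<close>; for \<open>q < k\<close> both truncated differences are 0, so nothing
      leaves.\<close>
    have inc': "int (S (Suc q - k)) = int (S (q - k)) + of_bool (S (q - k) < S (Suc q - k))"
    proof (cases "k \<le> q")
      case True
      then show ?thesis
        using arg_cong[OF full_blocks_Suc[OF n, of s "q - k"], of int] unfolding S_def
        by (simp add: Suc_diff_le)
    next
      case False
      then show ?thesis by (simp add: S_def)
    qed
    have bi: "cnt_b c ! (q mod k) = (S (q - k) < S (Suc q - k))"
      using b[of q] k by simp
    have qk: "q mod k < k" using k by simp
    have add: "counter_add (n * k) k x c =
      \<lparr>cnt_y = cnt_y c + of_bool x - int n * of_bool (S q < S (Suc q)), cnt_m = 0,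
       cnt_i = (q mod k + 1) mod k,
       cnt_B = cnt_B c - of_bool (S (q - k) < S (Suc q - k)) + of_bool (S q < S (Suc q)),
       cnt_b = (cnt_b c)[q mod k := (S q < S (Suc q))]\<rparr>"
      using True m full len qk unfolding counter_add_def wk Let_def i bi
      by (auto simp: i bi)
    \<comment> \<open>The slot just written is next read at \<open>j = q + k\<close>. Every other
      \<open>j\<close> satisfies \<open>0 < j - q < k\<close>, so its slot is untouched.\<close>
    have "(cnt_b c)[q mod k := (S q < S (Suc q))] ! (j mod k) = (S (j - k) < S (Suc j - k))"
      if j: "Suc q \<le> j" "j < Suc q + k" for j
    proof (cases "j = q + k")
      case True
      then show ?thesis using qk len by (simp add: Suc_diff_le)
    next
      case False
      have "j mod k \<noteq> q mod k"
      proof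
        assume "j mod k = q mod k"
        then have "k dvd j - q" using j by (simp add: mod_eq_dvd_iff_nat)
        then show False using j False by (auto dest!: dvd_imp_le)
      qed
      with b[of j] j False show ?thesis by simp
    qed
    then show ?thesis
      unfolding step add dm using y B inc inc' len
      by (auto simp: x_def algebra_simps mod_Suc_eq)
  next
    case False
    then have "Suc t div n = q" "Suc t mod n = Suc (t mod n)"
      by (auto simp: div_Suc mod_Suc q_def)
    moreover have "counter_add (n * k) k x c = c\<lparr>cnt_y := cnt_y c + of_bool x, cnt_m := cnt_m c + 1\<rparr>"
      using False m unfolding counter_add_def wk by (auto simp: Let_def)
    ultimately show ?thesis
      unfolding step using y m i B len b by (auto simp: x_def)
  qed
qed

text \<open>If the bit is set, the remainder reaches \<open>n\<close> by the block's end; the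
  \<open>n - m\<close> bits still to come force it to be at least \<open>m\<close> already, and it
  starts below \<open>n\<close>, so it is less than \<open>n + m\<close>. If the bit is not set, it
  stays below \<open>n\<close> up to the end, hence throughout by monotonicity.\<close>

lemma remainder_bounds:
  fixes n m :: nat and s :: "nat \<Rightarrow> bool"
  assumes n: "n > 0" and m: "m < n"
  defines "S \<equiv> full_blocks n s"
  shows "n * S p + m * of_bool (S p < S (Suc p)) \<le> ones s (p * n + m)"
    and "ones s (p * n + m) \<le> n * S p + m * of_bool (S p < S (Suc p)) + n"
proof -
  have start: "n * S p \<le> ones s (p * n)" "ones s (p * n) < n * S p + n"
    using n dividend_less_times_div[of n "ones s (p * n)"]
    by (auto simp: S_def full_blocks_def)
  have stop: "n * S (Suc p) \<le> ones s (p * n + n)" "ones s (p * n + n) < n * S (Suc p) + n"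
    using n dividend_less_times_div[of n "ones s (p * n + n)"]
    by (auto simp: S_def full_blocks_def add.commute)
  have mid: "ones s (p * n) \<le> ones s (p * n + m)" "ones s (p * n + m) \<le> ones s (p * n) + m"
    by (rule ones_le_add ones_add_le)+
  have rest: "ones s (p * n + m) \<le> ones s (p * n + n)"
    "ones s (p * n + n) \<le> ones s (p * n + m) + (n - m)"
    using ones_le_add[of s "p * n + m" "n - m"] ones_add_le[of s "p * n + m" "n - m"] m by simp_all
  have inc: "S (Suc p) = S p + of_bool (S p < S (Suc p))"
    unfolding S_def by (rule full_blocks_Suc[OF n])
  have "n * S p + m * of_bool (S p < S (Suc p)) \<le> ones s (p * n + m) \<and>
    ones s (p * n + m) \<le> n * S p + m * of_bool (S p < S (Suc p)) + n"
  proof (cases "S p < S (Suc p)")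
    case True
    then have "n * S (Suc p) = n * S p + n" using inc by simp
    with True start stop mid rest m show ?thesis by simp
  next
    case False
    then have "n * S (Suc p) = n * S p" using inc by simp
    with False start stop mid rest show ?thesis by simp
  qed
  then show "n * S p + m * of_bool (S p < S (Suc p)) \<le> ones s (p * n + m)"
    and "ones s (p * n + m) \<le> n * S p + m * of_bool (S p < S (Suc p)) + n"
    by auto
qed

theorem theorem7:
  fixes W k :: nat and \<epsilon> :: real and s :: "nat \<Rightarrow> bool" and t :: nat
  assumes "W \<ge> 1" and "\<epsilon> > 0"
    and "real k = 1 / (2 * \<epsilon>)"
    and "real W / real k \<in> \<int>"
  shows "\<bar>counter_query W k (counter_run W k s t) - real (window_count W s t)\<bar> \<le> real W * \<epsilon>"
proof -
  have k: "k > 0"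
    using assms(2,3) by (metis divide_pos_pos mult_pos_pos of_nat_0_less_iff zero_less_numeral zero_less_one)
  obtain z where z: "real W / real k = of_int z"
    using assms(4) by (auto elim: Ints_cases)
  have "z > 0"
    using z k assms(1) by (metis divide_pos_pos of_int_0_less_iff of_nat_0_less_iff less_le_trans zero_less_one)
  define n where "n = nat z"
  have n: "n > 0" and Wk: "real W / real k = real n"
    using \<open>z > 0\<close> z by (simp_all add: n_def)
  have "real W = real (n * k)"
    using Wk k by (simp add: field_simps)
  then have W: "W = n * k" by (simp only: of_nat_eq_iff)
  have We: "real W * \<epsilon> = real n / 2"
  proof -
    have "\<epsilon> = 1 / (2 * real k)" using assms(2,3) by simp
    then show ?thesis using Wk by simp
  qed
  define q where "q = t div n"
  define m where "m = t mod n"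
  define S where "S = full_blocks n s"
  define \<beta> where "\<beta> \<longleftrightarrow> S (q - k) < S (Suc q - k)"
  define c where "c = counter_run W k s t"
  have inv: "cnt_y c = int (ones s t) - int n * int (S q)" "cnt_m c = int m"
    "cnt_i c = q mod k" "cnt_B c = int (S q) - int (S (q - k))" "cnt_b c ! (q mod k) = \<beta>"
    using counter_run_invariant[OF n k, of s t] k
    by (auto simp: c_def W q_def m_def S_def \<beta>_def)
  have t: "t = q * n + m" and m: "m < n"
    using n by (simp_all add: q_def m_def)
  \<comment> \<open>The terms \<open>n * S q\<close> in \<open>n * B\<close> and \<open>y\<close>
    cancel, leaving only the quotient at the old end of the window.\<close>
  have query: "counter_query W k c
      = real (ones s t) - real n * real (S (q - k)) - real n / 2 - real m * of_bool \<beta>"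
  proof -
    have "real W / (2 * real k) = real n / 2" using Wk by (simp add: field_simps)
    then show ?thesis
      unfolding counter_query_def Wk inv by (simp add: algebra_simps)
  qed
  have le: "ones s (t - W) \<le> ones s t"
    using ones_le_add[of s "t - W" "t - (t - W)"] by simp
  have "n * S (q - k) + m * of_bool \<beta> \<le> ones s (t - W)
    \<and> ones s (t - W) \<le> n * S (q - k) + m * of_bool \<beta> + n"
  proof (cases "k \<le> q")
    case True
    then have "t - W = (q - k) * n + m"
      unfolding t W by (auto simp: le_iff_add algebra_simps)
    moreover have "\<beta> \<longleftrightarrow> S (q - k) < S (Suc (q - k))"
      using True by (simp add: \<beta>_def Suc_diff_le)
    ultimately show ?thesis
      using remainder_bounds[OF n m, of s "q - k"] by (simp add: S_def)
  next
    case False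
    \<comment> \<open>The window covers the whole stream so far: \<open>ones s (t - W)\<close>,
      \<open>S (q - k)\<close> and the bit \<beta> all vanish.\<close>
    then have "Suc q * n \<le> k * n" by (intro mult_le_mono1) simp
    then have "t \<le> W" using m by (simp add: t W mult.commute)
    with False show ?thesis by (simp add: \<beta>_def S_def)
  qed
  then have "real (n * S (q - k) + m * of_bool \<beta>) \<le> real (ones s (t - W))"
    "real (ones s (t - W)) \<le> real (n * S (q - k) + m * of_bool \<beta> + n)"
    by (simp_all only: of_nat_le_iff)
  then show ?thesis
    unfolding c_def[symmetric] query We window_count_eq of_nat_diff[OF le]
    unfolding abs_le_iff of_nat_add of_nat_mult of_nat_of_bool by linarith
qed

end
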